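(* Let $\mathcal{A}=(a_{i_1\cdots i_k})\in\mathbb{R}^{n\times\cdots\times n}$ with $k\ge3$. Then $\mathcal{A}$ has an order $2$ sign right inverse if and only if there exist an $n\times n$ permutation matrix $P$ and an $n\times n$ diagonal matrix $D$ with diagonal entries in $\{1,-1\}$, where moreover $D=I$ when $k$ is odd, such that ${\rm sgn}(\mathcal{A})=DP\cdot\mathcal{I}$.
   Context: For dimension $n$ tensors $\mathcal{A}=(a_{i_1\cdots i_m})$ (order $m\ge2$) and $\mathcal{B}=(b_{i_1\cdots i_k})$, the product $\mathcal{A}\cdot\mathcal{B}$ has entries $(\mathcal{A}\cdot\mathcal{B})_{i\alpha_1\cdots\alpha_{m-1}}=\sum_{i_2,\ldots,i_m\in[n]}a_{ii_2\cdots i_m}b_{i_2\alpha_1}\cdots b_{i_m\alpha_{m-1}}$, $\alpha_j\in[n]^{k-1}$; in particular for an $n\times n$ matrix $M=(m_{ij})$, $M\cdot\mathcal{I}$ is the order $k$ tensor with entries $(M\cdot\mathcal{I})_{ij_2\cdots j_k}=m_{ij}$ if $j_2=\cdots=j_k=j$ and $0$ otherwise. $\mathcal{I}$ is the order $k$ dimension $n$ unit tensor. An order $2$ right inverse of $\mathcal{B}$ is an $n\times n$ matrix $Q$ with $\mathcal{B}\cdot Q=\mathcal{I}$. ${\rm sgn}$ denotes the entrywise sign, and $\mathcal{Q}(\mathcal{A})$ is the set of real tensors with the same sign pattern as $\mathcal{A}$; $\mathcal{A}$ has an order $2$ sign right inverse if every tensor in $\mathcal{Q}(\mathcal{A})$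 has an order $2$ right inverse. *)

theory Defs
  imports "HOL-Analysis.Analysis" "HOL-Combinatorics.Permutations"
begin

text \<open>A real tensor of order \<open>k\<close> and dimension \<open>n\<close> is a function on index lists over a finite type
  \<open>'n\<close> with \<open>CARD('n) = n\<close>. Only lists of length \<open>k\<close> carry entries. Elsewhere the function is
  required to be zero, so that equality of functions is equality of tensors.\<close>

type_synonym 'n tensor = "'n list \<Rightarrow> real"

definition tensors :: "nat \<Rightarrow> 'n tensor set" where
  "tensors k = {A. \<forall>is. length is \<noteq> k \<longrightarrow> A is = 0}"

definition unit_tensor :: "nat \<Rightarrow> 'n tensor" where
  "unit_tensor k = (\<lambda>is. if \<exists>i. is = replicate k i then 1 else 0)"

definition tensor_of_matrix :: "real ^ 'n ^ 'n \<Rightarrow> 'n tensor" where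
  "tensor_of_matrix M = (\<lambda>is. if length is = 2 then M $ (is ! 0) $ (is ! 1) else 0)"

text \<open>\<open>tensor_prod m k A B\<close> is the product of \<open>A\<close> of order \<open>m\<close> and \<open>B\<close> of order \<open>k\<close>. It has order
  \<open>(m - 1) * (k - 1) + 1\<close>, with indices \<open>i # \<alpha>\<^sub>1 @ \<dots> @ \<alpha>\<^bsub>m-1\<^esub>\<close>, each block \<open>\<alpha>\<^sub>j\<close> having length
  \<open>k - 1\<close>. Blocks are counted from \<open>t = 0\<close>, and the list \<open>js\<close> stands for the summation
  indices \<open>i\<^sub>2, \<dots>, i\<^sub>m\<close>.\<close>

definition tensor_prod :: "nat \<Rightarrow> nat \<Rightarrow> 'n::finite tensor \<Rightarrow> 'n tensor \<Rightarrow> 'n tensor" where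
  "tensor_prod m k A B = (\<lambda>is.
     if length is = (m - 1) * (k - 1) + 1
     then \<Sum>js\<in>{js. length js = m - 1}.
            A (hd is # js) *
            (\<Prod>t<m - 1. B (js ! t # take (k - 1) (drop (t * (k - 1)) (tl is))))
     else 0)"

definition sgn_tensor :: "'n tensor \<Rightarrow> 'n tensor" where
  "sgn_tensor A = (\<lambda>is. sgn (A is))"

definition sign_class :: "nat \<Rightarrow> 'n tensor \<Rightarrow> 'n tensor set" where
  "sign_class k A = {B \<in> tensors k. sgn_tensor B = sgn_tensor A}"

definition is_order2_right_inverse ::
    "nat \<Rightarrow> 'n::finite tensor \<Rightarrow> real ^ 'n ^ 'n \<Rightarrow> bool" where
  "is_order2_right_inverse k B Q \<longleftrightarrow> tensor_prod k 2 B (tensor_of_matrix Q) = unit_tensor k"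

definition has_order2_sign_right_inverse :: "nat \<Rightarrow> 'n::finite tensor \<Rightarrow> bool" where
  "has_order2_sign_right_inverse k A \<longleftrightarrow>
     (\<forall>B\<in>sign_class k A. \<exists>Q. is_order2_right_inverse k B Q)"

definition permutation_matrix :: "real ^ 'n ^ 'n \<Rightarrow> bool" where
  "permutation_matrix P \<longleftrightarrow>
     (\<exists>p. p permutes UNIV \<and> P = (\<chi> i j. if j = p i then 1 else 0))"

definition diagonal_matrix :: "real ^ 'n ^ 'n \<Rightarrow> bool" where
  "diagonal_matrix D \<longleftrightarrow> (\<forall>i j. i \<noteq> j \<longrightarrow> D $ i $ j = 0)"

lemma length_one_lists: "{js. length js = Suc 0} = range (\<lambda>j. [j])"
  by (auto simp: length_Suc_conv)

lemma tensor_prod_matrix_left: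
  fixes B :: "'n::finite tensor"
  assumes "1 \<le> k" "length is = k"
  shows "tensor_prod 2 k (tensor_of_matrix M) B is = (\<Sum>j\<in>UNIV. M $ hd is $ j * B (j # tl is))"
  using assms
  by (simp add: tensor_prod_def tensor_of_matrix_def length_one_lists
      sum.reindex inj_on_def numeral_2_eq_2)

lemma tensor_prod_matrix_unit:
  fixes M :: "real ^ 'n::finite ^ 'n"
  assumes "2 \<le> k" "length js = k - 1"
  shows "tensor_prod 2 k (tensor_of_matrix M) (unit_tensor k) (i # js) =
    (if \<exists>j. js = replicate (k - 1) j then M $ i $ hd js else 0)"
proof -
  obtain l where k: "k = Suc (Suc l)"
    using assms(1) by (metis One_nat_def Suc_1 Suc_le_D Suc_le_mono)
  have *: "(\<exists>i. j # js = replicate k i) \<longleftrightarrow> js = replicate (k - 1) j" for j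
    by (auto simp: k)
  have "tensor_prod 2 k (tensor_of_matrix M) (unit_tensor k) (i # js) =
      (\<Sum>j\<in>UNIV. M $ i $ j * (if js = replicate (k - 1) j then 1 else 0))"
    using assms by (subst tensor_prod_matrix_left) (auto simp: unit_tensor_def *)
  also have "\<dots> = (if \<exists>j. js = replicate (k - 1) j then M $ i $ hd js else 0)"
  proof (cases "\<exists>j. js = replicate (k - 1) j")
    case True
    then obtain j where j: "js = replicate (k - 1) j" by blast
    have "js = replicate (k - 1) j' \<longleftrightarrow> j' = j" for j'
      using j by (auto simp: k)
    then have "(\<Sum>j'\<in>UNIV. M $ i $ j' * (if js = replicate (k - 1) j' then 1 else 0)) =
        (\<Sum>j'\<in>UNIV. if j' = j then M $ i $ j' else 0)"
      by (intro sum.cong) auto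
    also have "\<dots> = M $ i $ j" by simp
    finally show ?thesis using True j by (simp add: k)
  qed (auto intro!: sum.neutral)
  finally show ?thesis .
qed

lemma tensor_prod_matrix_right:
  fixes B :: "'n::finite tensor"
  assumes "2 \<le> k" "length js = k - 1"
  shows "tensor_prod k 2 B (tensor_of_matrix Q) (i # js) =
    (\<Sum>is\<in>{is. length is = k - 1}. B (i # is) * (\<Prod>t<k - 1. Q $ (is ! t) $ (js ! t)))"
proof -
  have "take 1 (drop t js) = [js ! t]" if "t < k - 1" for t
    using that assms by (simp add: take_Suc_conv_app_nth)
  then show ?thesis
    using assms by (auto simp: tensor_prod_def tensor_of_matrix_def intro!: sum.cong prod.cong)
qed

end

theory Submission
  imports Defs
begin

text \<open>If \<open>\<B> \<cdot> Q = \<I>\<close> then \<open>Q\<close> is invertible, and with \<open>R = Q\<^sup>-\<^sup>1\<close> each slice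
  of \<open>\<B>\<close> is a power of a row of \<open>R\<close>: \<open>b\<close> at \<open>(i, i\<^sub>2, \<dots>, i\<^sub>k)\<close> equals
  \<open>r(i, i\<^sub>2) \<cdots> r(i, i\<^sub>k)\<close>. If row \<open>i\<close> had nonzero entries at \<open>a \<noteq> b\<close>, doubling
  the single entry at \<open>(i, a, \<dots>, a)\<close> would destroy this shape without changing the sign
  pattern, because the entries at \<open>(i, b, \<dots>, b)\<close> and \<open>(i, b, a, \<dots>, a)\<close> already fix the
  absolute value of \<open>r(i, a)\<close>; this needs \<open>k \<ge> 3\<close>. So \<open>R\<close> is a monomial matrix, and the nonzero
  entries of \<open>\<A>\<close> are the \<open>(k-1)\<close>-st powers of its entries. Conversely, such tensors are
  inverted by taking \<open>(k-1)\<close>-st roots.\<close>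

section \<open>Sums over index lists of fixed length\<close>

lemma lists_length_Suc:
  "{xs. length xs = Suc n} = (\<lambda>(x, xs). x # xs) ` (UNIV \<times> {xs. length xs = n})"
  by (auto simp: length_Suc_conv image_iff)

lemma sum_lists_Suc:
  "(\<Sum>xs\<in>{xs::'a list. length xs = Suc n}. f xs) =
   (\<Sum>x\<in>UNIV. \<Sum>xs\<in>{xs. length xs = n}. f (x # xs))"
proof -
  have inj: "inj_on (\<lambda>(x, xs). x # xs) (UNIV \<times> {xs::'a list. length xs = n})"
    by (auto simp: inj_on_def)
  show ?thesis
    unfolding lists_length_Suc sum.reindex[OF inj] sum.cartesian_product
    by (simp add: case_prod_unfold)
qed

lemma finite_lists_length: "finite {xs::'a::finite list. length xs = n}"
  using finite_lists_length_eq[of "UNIV :: 'a set" n] by simp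

text \<open>Distributivity: the list \<open>xs\<close> records which summand is chosen in each
  factor. This turns a separate contraction in each slot into a single sum over index lists.\<close>

lemma prod_sum_lists:
  fixes f :: "nat \<Rightarrow> 'a::finite \<Rightarrow> 'b::comm_semiring_1"
  shows "(\<Prod>t<n. \<Sum>x\<in>UNIV. f t x) = (\<Sum>xs\<in>{xs. length xs = n}. \<Prod>t<n. f t (xs ! t))"
proof (induction n arbitrary: f)
  case (Suc n)
  show ?case
    unfolding sum_lists_Suc prod.lessThan_Suc_shift
    by (simp add: Suc sum_product)
qed simp

lemma prod_indicator_nth:
  assumes "length xs = n" "length ys = n"
  shows "(\<Prod>t<n. if xs ! t = ys ! t then 1 else 0) = (if xs = ys then 1 else (0::'b::comm_semiring_1))"
proof (cases "xs = ys")
  case False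
  then obtain t where "t < n" "xs ! t \<noteq> ys ! t"
    using assms by (metis nth_equalityI)
  then show ?thesis
    using False by (auto intro!: prod_zero)
qed simp

section \<open>The structure forced by one order 2 right inverse\<close>

lemma right_inverse_entry:
  fixes B :: "'n::finite tensor"
  assumes "is_order2_right_inverse k B Q" "2 \<le> k" "length js = k - 1"
  shows "(\<Sum>is\<in>{is. length is = k - 1}. B (i # is) * (\<Prod>t<k - 1. Q $ (is ! t) $ (js ! t))) =
    (if js = replicate (k - 1) i then 1 else 0)"
proof -
  have k: "replicate k j = j # replicate (k - 1) j" for j :: 'n
    using assms(2) by (cases k) auto
  show ?thesis
    using assms tensor_prod_matrix_right[of k js B Q i]
    by (auto simp: is_order2_right_inverse_def unit_tensor_def k)
qed

text \<open>A kernel vector \<open>c\<close> of \<open>Q\<close> is tested against the entries at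
  (i, j, i, ..., i), weighted by \<open>c $ j\<close> and summed over j. The unit tensor yields
  \<open>c $ i\<close>, while the product yields a sum in which every term has an entry of
  \<open>Q *v c\<close> as a factor.\<close>

lemma invertible_right_inverse:
  fixes B :: "'n::finite tensor"
  assumes Q: "is_order2_right_inverse k B Q" and k: "2 \<le> k"
  shows "invertible Q"
proof -
  obtain l where l: "k - Suc 0 = Suc l"
    using k by (cases "k - 1") auto
  have "c = 0" if c: "Q *v c = 0" for c
  proof -
    have "c $ i = 0" for i
    proof -
      have "c $ i = (\<Sum>j\<in>UNIV. c $ j * (if j # replicate l i = replicate (k - 1) i then 1 else 0))"
        by (simp add: l if_distrib[of "(*) _"] cong: if_cong)
      also have "\<dots> = (\<Sum>j\<in>UNIV. \<Sum>is\<in>{is. length is = k - 1}. c $ j *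
          (B (i # is) * (\<Prod>t<k - 1. Q $ (is ! t) $ ((j # replicate l i) ! t))))"
        unfolding sum_distrib_left[symmetric]
        by (intro sum.cong refl, subst right_inverse_entry[OF Q k]) (simp_all add: l)
      also have "\<dots> = (\<Sum>is\<in>{is. length is = k - 1}. \<Sum>j\<in>UNIV. c $ j *
          (B (i # is) * (\<Prod>t<k - 1. Q $ (is ! t) $ ((j # replicate l i) ! t))))"
        by (rule sum.swap)
      \<comment> \<open>Only the factor at position 0 depends on j, so the sum over j acts on that
        factor alone.\<close>
      also have "\<dots> = (\<Sum>is\<in>{is. length is = k - 1}. (Q *v c) $ (is ! 0) *
          (B (i # is) * (\<Prod>t<l. Q $ (is ! Suc t) $ i)))"
        unfolding One_nat_def l prod.lessThan_Suc_shift
        by (simp add: matrix_vector_mult_def sum_distrib_left sum_distrib_right mult_ac)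
      also have "\<dots> = 0"
        by (simp add: c)
      finally show ?thesis .
    qed
    then show ?thesis by (simp add: vec_eq_iff)
  qed
  then show ?thesis
    by (simp add: invertible_left_inverse matrix_left_invertible_ker)
qed

text \<open>Multiplying on the right by the inverse \<open>R\<close> of \<open>Q\<close> gives B =
  B(QR) = (BQ)R = IR, and the entries of IR are products along one row of \<open>R\<close>. The
  proof carries out this associativity on entries.\<close>

lemma right_inverse_imp_rank_one_slices:
  fixes B :: "'n::finite tensor"
  assumes Q: "is_order2_right_inverse k B Q" and k: "2 \<le> k"
  obtains R where "R ** Q = mat 1"
    "\<And>i js. length js = k - 1 \<Longrightarrow> B (i # js) = (\<Prod>t<k - 1. R $ i $ (js ! t))"
proof -
  obtain R where R: "Q ** R = mat 1" "R ** Q = mat 1"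
    using invertible_right_inverse[OF assms] by (auto simp: invertible_def)
  have QR: "(\<Sum>j\<in>UNIV. Q $ a $ j * R $ j $ b) = (if a = b then 1 else 0)" for a b
    using arg_cong[OF R(1), of "\<lambda>M. M $ a $ b"] by (simp add: matrix_matrix_mult_def mat_def)
  have "B (i # js) = (\<Prod>t<k - 1. R $ i $ (js ! t))" if js: "length js = k - 1" for i js
  proof -
    let ?L = "{xs::'n list. length xs = k - 1}"
    \<comment> \<open>The indicator of equal lists is a product of Kronecker deltas, one per slot,
      and each delta is an entry of \<open>Q ** R\<close>.\<close>
    have "B (i # js) = (\<Sum>is\<in>?L. B (i # is) * (if is = js then 1 else 0))"
      using js by (simp add: if_distrib[of "(*) _"] finite_lists_length cong: if_cong)
    also have "\<dots> = (\<Sum>is\<in>?L. B (i # is) *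
        (\<Prod>t<k - 1. \<Sum>j\<in>UNIV. Q $ (is ! t) $ j * R $ j $ (js ! t)))"
      using js by (intro sum.cong refl) (simp add: QR prod_indicator_nth)
    also have "\<dots> = (\<Sum>is\<in>?L. \<Sum>ls\<in>?L. B (i # is) *
        (\<Prod>t<k - 1. Q $ (is ! t) $ (ls ! t) * R $ (ls ! t) $ (js ! t)))"
      by (simp add: prod_sum_lists sum_distrib_left)
    also have "\<dots> = (\<Sum>ls\<in>?L. \<Sum>is\<in>?L. B (i # is) *
        (\<Prod>t<k - 1. Q $ (is ! t) $ (ls ! t) * R $ (ls ! t) $ (js ! t)))"
      by (rule sum.swap)
    also have "\<dots> = (\<Sum>ls\<in>?L. (\<Sum>is\<in>?L. B (i # is) * (\<Prod>t<k - 1. Q $ (is ! t) $ (ls ! t))) *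
        (\<Prod>t<k - 1. R $ (ls ! t) $ (js ! t)))"
      unfolding prod.distrib sum_distrib_right by (simp only: mult.assoc)
    also have "\<dots> = (\<Sum>ls\<in>?L. (if ls = replicate (k - 1) i then 1 else 0) *
        (\<Prod>t<k - 1. R $ (ls ! t) $ (js ! t)))"
      by (intro sum.cong refl) (subst right_inverse_entry[OF Q k], simp_all)
    also have "\<dots> = (\<Prod>t<k - 1. R $ i $ (js ! t))"
      by (simp add: if_distrib[of "\<lambda>x. x * _"] finite_lists_length cong: if_cong)
    finally show ?thesis .
  qed
  then show ?thesis using that R by blast
qed

section \<open>Perturbing one entry within the sign class\<close>

lemma sign_right_inverse_row_support:
  fixes A :: "'n::finite tensor"
  assumes A: "has_order2_sign_right_inverse k A" "A \<in> tensors k" and k: "3 \<le> k"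
    and R: "\<And>i js. length js = k - 1 \<Longrightarrow> A (i # js) = (\<Prod>t<k - 1. R $ i $ (js ! t))"
    and nz: "R $ i $ a \<noteq> 0" "R $ i $ b \<noteq> 0"
  shows "a = b"
proof (rule ccontr)
  assume "a \<noteq> b"
  obtain l where l: "k - Suc 0 = Suc l" "0 < l"
    using k by (cases "k - 1") auto
  define B where "B = A(i # replicate (k - 1) a := 2 * A (i # replicate (k - 1) a))"
  have "B \<in> sign_class k A"
    using A(2) k by (auto simp: B_def sign_class_def tensors_def sgn_tensor_def sgn_mult)
  then obtain Q where Q: "is_order2_right_inverse k B Q"
    using A(1) by (auto simp: has_order2_sign_right_inverse_def)
  obtain S where S:
    "\<And>i js. length js = k - 1 \<Longrightarrow> B (i # js) = (\<Prod>t<k - 1. S $ i $ (js ! t))"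
  proof -
    have "2 \<le> k" using k by simp
    from right_inverse_imp_rank_one_slices[OF Q this] that show thesis by blast
  qed
  have diag: "(\<Prod>t<k - 1. M $ i $ (replicate (k - 1) c ! t)) = (M $ i $ c) ^ (k - 1)"
    for M :: "real ^ 'n ^ 'n" and c by simp
  have mixed: "(\<Prod>t<k - 1. M $ i $ ((b # replicate l a) ! t)) = M $ i $ b * (M $ i $ a) ^ l"
    for M :: "real ^ 'n ^ 'n"
    unfolding One_nat_def l(1) prod.lessThan_Suc_shift by simp
  have "(S $ i $ b) ^ (k - 1) = (R $ i $ b) ^ (k - 1)"
    using S[of "replicate (k - 1) b" i] R[of "replicate (k - 1) b" i] \<open>a \<noteq> b\<close> l
    unfolding diag by (simp add: B_def)
  \<comment> \<open>For odd \<open>k\<close> the exponent is even and determines the entry only up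
    to sign, hence absolute values.\<close>
  from arg_cong[OF this, of abs] have "\<bar>S $ i $ b\<bar> ^ (k - 1) = \<bar>R $ i $ b\<bar> ^ (k - 1)"
    by (simp add: power_abs)
  then have b: "\<bar>S $ i $ b\<bar> = \<bar>R $ i $ b\<bar>"
    by (rule power_eq_imp_eq_base) (use k in auto)
  \<comment> \<open>The entry read here is unmodified because its index list has b after i. Since
    \<open>l > 0\<close>, which is where \<open>3 \<le> k\<close> enters, it still constrains the
    entry of \<open>S\<close> at a.\<close>
  have "S $ i $ b * (S $ i $ a) ^ l = R $ i $ b * (R $ i $ a) ^ l"
    using S[of "b # replicate l a" i] R[of "b # replicate l a" i] \<open>a \<noteq> b\<close>
    unfolding mixed by (simp add: B_def l)
  from arg_cong[OF this, of abs] have "\<bar>S $ i $ a\<bar> ^ l = \<bar>R $ i $ a\<bar> ^ l"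
    using nz(2) by (simp add: abs_mult power_abs b)
  then have a: "\<bar>S $ i $ a\<bar> = \<bar>R $ i $ a\<bar>"
    by (rule power_eq_imp_eq_base) (use l in auto)
  have "(S $ i $ a) ^ (k - 1) = 2 * (R $ i $ a) ^ (k - 1)"
    using S[of "replicate (k - 1) a" i] R[of "replicate (k - 1) a" i]
    unfolding diag by (simp add: B_def)
  from arg_cong[OF this, of abs] have "\<bar>S $ i $ a\<bar> ^ (k - 1) = 2 * \<bar>R $ i $ a\<bar> ^ (k - 1)"
    by (simp add: abs_mult power_abs)
  then show False
    using a nz(1) by simp
qed

section \<open>Monomial sign patterns\<close>

text \<open>Row i of \<open>D ** P\<close> can be nonzero only in column \<open>p i\<close>, and at
  lists of length other than \<open>k\<close> both tensors vanish. Both directions of the theorem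
  pass through this entrywise form.\<close>

lemma sgn_tensor_eq_monomial_iff:
  fixes A :: "'n::finite tensor"
  assumes A: "A \<in> tensors k" and k: "2 \<le> k" and D: "diagonal_matrix D"
    and P: "P = (\<chi> i j. if j = p i then 1 else 0)"
  shows "sgn_tensor A = tensor_prod 2 k (tensor_of_matrix (D ** P)) (unit_tensor k) \<longleftrightarrow>
    (\<forall>i js. length js = k - 1 \<longrightarrow>
      sgn (A (i # js)) = (if js = replicate (k - 1) (p i) then D $ i $ i else 0))"
    (is "_ = ?T \<longleftrightarrow> ?E")
proof -
  obtain l where l: "k - Suc 0 = Suc l"
    using k by (cases "k - 1") auto
  have DP: "(D ** P) $ i $ j = (if j = p i then D $ i $ i else 0)" for i j
  proof -
    have "(D ** P) $ i $ j = (\<Sum>m\<in>UNIV. if m = i then D $ i $ m * P $ m $ j else 0)"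
      unfolding matrix_matrix_mult_def vec_lambda_beta
      by (intro sum.cong refl) (use D in \<open>auto simp: diagonal_matrix_def\<close>)
    then show ?thesis by (simp add: P)
  qed
  have T: "?T (i # js) = (if js = replicate (k - 1) (p i) then D $ i $ i else 0)"
    if "length js = k - 1" for i js
    using tensor_prod_matrix_unit[OF k that, of "D ** P" i] by (auto simp: DP l)
  have T0: "?T is = 0" if "length is \<noteq> k" for "is"
    using that k by (auto simp: tensor_prod_def)
  show ?thesis
  proof
    assume "sgn_tensor A = ?T"
    then show ?E using T by (metis sgn_tensor_def)
  next
    assume E: ?E
    show "sgn_tensor A = ?T"
    proof
      fix "is" :: "'n list"
      show "sgn_tensor A is = ?T is"
      proof (cases "length is = k")
        case True
        then obtain i js where "is = i # js" "length js = k - 1"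
          using k by (cases "is") auto
        then show ?thesis using E T by (simp add: sgn_tensor_def)
      next
        case False
        then show ?thesis using A T0 by (simp add: sgn_tensor_def tensors_def)
      qed
    qed
  qed
qed

text \<open>Each slice of \<open>B\<close> has one nonzero entry \<open>b i\<close>, so contracting
  with \<open>Q\<close> leaves \<open>b i\<close> times a product along row \<open>p i\<close> of
  \<open>Q\<close>. A real (k-1)-st root of \<open>b i\<close> lets that row absorb the
  factor.\<close>

lemma monomial_sign_imp_right_inverse:
  fixes B :: "'n::finite tensor"
  assumes p: "p permutes UNIV" and k: "2 \<le> k"
    and d: "\<And>i. d i \<in> {1, - 1 :: real}" "odd k \<Longrightarrow> d = (\<lambda>i. 1)"
    and B: "\<And>i js. length js = k - 1 \<Longrightarrow>
      sgn (B (i # js)) = (if js = replicate (k - 1) (p i) then d i else 0)"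
  shows "\<exists>Q. is_order2_right_inverse k B Q"
proof -
  let ?L = "{xs::'n list. length xs = k - 1}"
  define b where "b i = B (i # replicate (k - 1) (p i))" for i
  define r where "r i = root (k - 1) (b i)" for i
  have sgn_b: "sgn (b i) = d i" for i
    using B[of "replicate (k - 1) (p i)" i] by (simp add: b_def)
  then have b_nz: "b i \<noteq> 0" for i
    using d(1)[of i] by (metis insertE sgn_0 singletonD zero_neq_neg_one zero_neq_one)
  \<comment> \<open>For odd \<open>k\<close> this is an even root and needs \<open>b i > 0\<close>,
    supplied by \<open>d = 1\<close>; for even \<open>k\<close> odd roots of negative numbers exist
    too.\<close>
  have r: "r i ^ (k - 1) = b i" for i
  proof (cases "odd k")
    case True
    then have "sgn (b i) = 1" using sgn_b d(2) by simp
    then have "0 < b i" by (simp add: sgn_1_pos)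
    then show ?thesis using k by (simp add: r_def)
  next
    case False
    then show ?thesis using k by (simp add: r_def odd_real_root_pow)
  qed
  \<comment> \<open>This is the inverse of the monomial matrix with entry \<open>r j\<close> at (j,
    p j).\<close>
  define Q :: "real ^ 'n ^ 'n" where "Q = (\<chi> a j. if a = p j then inverse (r j) else 0)"
  have Bij: "B (i # js) = (if js = replicate (k - 1) (p i) then b i else 0)"
    if "length js = k - 1" for i js
    using B[OF that, of i] by (auto simp: b_def sgn_0_0 split: if_splits)
  have inj: "p i = p j \<longleftrightarrow> i = j" for i j
    using permutes_inj[OF p] by (auto dest: injD)
  have "tensor_prod k 2 B (tensor_of_matrix Q) is = unit_tensor k is" for "is"
  proof (cases "length is = k")
    case False
    then show ?thesis using k by (auto simp: tensor_prod_def unit_tensor_def)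
  next
    case True
    then obtain i js where "is": "is = i # js" and js: "length js = k - 1"
      using k by (cases "is") auto
    have "tensor_prod k 2 B (tensor_of_matrix Q) is =
        (\<Sum>ls\<in>?L. B (i # ls) * (\<Prod>t<k - 1. Q $ (ls ! t) $ (js ! t)))"
      unfolding "is" by (rule tensor_prod_matrix_right[OF k js])
    also have "\<dots> = (\<Sum>ls\<in>?L. if ls = replicate (k - 1) (p i)
        then b i * (\<Prod>t<k - 1. Q $ p i $ (js ! t)) else 0)"
      by (intro sum.cong refl) (auto simp: Bij)
    also have "\<dots> = b i * (\<Prod>t<k - 1. Q $ p i $ (js ! t))"
      by (simp add: finite_lists_length)
    \<comment> \<open>Writing i as an entry of \<open>replicate (k - 1) i\<close> makes the
      indicators multiply to a comparison of two lists.\<close>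
    also have "(\<Prod>t<k - 1. Q $ p i $ (js ! t)) =
        (\<Prod>t<k - 1. inverse (r i) * (if js ! t = replicate (k - 1) i ! t then 1 else 0))"
      by (intro prod.cong refl) (auto simp: Q_def inj)
    also have "\<dots> = inverse (b i) * (if js = replicate (k - 1) i then 1 else 0)"
      using js by (simp add: prod.distrib prod_indicator_nth power_inverse r[unfolded One_nat_def]
          del: nth_replicate)
    also have "b i * \<dots> = (if js = replicate (k - 1) i then 1 else 0)"
      using b_nz by simp
    also have "\<dots> = unit_tensor k is"
      using k by (cases k) (auto simp: unit_tensor_def "is")
    finally show ?thesis .
  qed
  then show ?thesis
    unfolding is_order2_right_inverse_def by blast
qed

section \<open>The equivalence\<close>

theorem theorem4p5:
  fixes A :: "'n::finite tensor" and k :: nat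
  assumes "k \<ge> 3" and "A \<in> tensors k"
  shows "has_order2_sign_right_inverse k A \<longleftrightarrow>
    (\<exists>P D :: real ^ 'n ^ 'n.
       permutation_matrix P \<and>
       diagonal_matrix D \<and> (\<forall>i. D $ i $ i \<in> {1, -1}) \<and>
       (odd k \<longrightarrow> D = mat 1) \<and>
       sgn_tensor A = tensor_prod 2 k (tensor_of_matrix (D ** P)) (unit_tensor k))"
proof
  have k: "2 \<le> k" using assms(1) by simp
  assume A: "has_order2_sign_right_inverse k A"
  have "A \<in> sign_class k A"
    using assms(2) by (simp add: sign_class_def)
  then obtain Q where Q: "is_order2_right_inverse k A Q"
    using A by (auto simp: has_order2_sign_right_inverse_def)
  obtain R where RQ: "R ** Q = mat 1"
    and R: "\<And>i js. length js = k - 1 \<Longrightarrow> A (i # js) = (\<Prod>t<k - 1. R $ i $ (js ! t))"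
    using right_inverse_imp_rank_one_slices[OF Q k] by blast
  note support = sign_right_inverse_row_support[OF A assms(2,1) R]
  have RQ_entry: "(\<Sum>j\<in>UNIV. R $ a $ j * Q $ j $ b) = (if a = b then 1 else 0)" for a b
    using arg_cong[OF RQ, of "\<lambda>M. M $ a $ b"] by (simp add: matrix_matrix_mult_def mat_def)
  have "\<exists>j. R $ i $ j \<noteq> 0" for i
  proof (rule ccontr)
    assume "\<not> ?thesis"
    then show False using RQ_entry[of i i] by simp
  qed
  then obtain p where p: "\<And>i. R $ i $ p i \<noteq> 0" by metis
  have R0: "R $ i $ j = 0" if "j \<noteq> p i" for i j
    using support p that by metis
  have Rp: "R $ a $ p a * Q $ p a $ b = (if a = b then 1 else 0)" for a b
  proof -
    have "(\<Sum>j\<in>UNIV. R $ a $ j * Q $ j $ b) =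
        (\<Sum>j\<in>UNIV. if j = p a then R $ a $ p a * Q $ p a $ b else 0)"
      by (intro sum.cong refl) (auto simp: R0)
    then show ?thesis using RQ_entry[of a b] by simp
  qed
  \<comment> \<open>If p a = p b with a and b distinct, then \<open>Rp\<close> at (a, b) makes the
    entry of \<open>Q\<close> at (p a, b) zero, while \<open>Rp\<close> at (b, b) makes it
    nonzero.\<close>
  have "inj p"
  proof (rule injI)
    fix a b assume "p a = p b"
    then show "a = b"
      using Rp[of a b] Rp[of b b] p[of a] by (auto split: if_splits)
  qed
  then have perm: "p permutes UNIV"
    by (simp add: permutes_def bij_iff[symmetric] bij_def finite_UNIV_inj_surj)
  define P :: "real ^ 'n ^ 'n" where "P = (\<chi> i j. if j = p i then 1 else 0)"
  \<comment> \<open>The nonzero entry of slice i of \<open>A\<close> is the (k-1)-st power of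
    \<open>R $ i $ p i\<close>; its sign is positive whenever \<open>k\<close> is odd.\<close>
  define D :: "real ^ 'n ^ 'n"
    where "D = (\<chi> i j. if i = j then sgn (R $ i $ p i) ^ (k - 1) else 0)"
  have D: "diagonal_matrix D"
    by (simp add: diagonal_matrix_def D_def)
  have sgn_R: "sgn (R $ i $ p i) = 1 \<or> sgn (R $ i $ p i) = -1" for i
    using p[of i] by (auto simp: sgn_if)
  have D_sign: "D $ i $ i \<in> {1, -1}" for i
    using sgn_R[of i] by (cases "even (k - 1)") (auto simp: D_def)
  have D_odd: "D = mat 1" if "odd k"
  proof -
    have "even (k - 1)" using that by simp
    then have "sgn (R $ i $ p i) ^ (k - 1) = 1" for i
      using sgn_R[of i] by auto
    then show ?thesis by (simp add: D_def mat_def vec_eq_iff)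
  qed
  have "sgn (A (i # js)) = (if js = replicate (k - 1) (p i) then D $ i $ i else 0)"
    if js: "length js = k - 1" for i js
  proof (cases "js = replicate (k - 1) (p i)")
    case True
    then show ?thesis by (simp add: R js D_def)
  next
    case False
    then obtain t where "t < k - 1" "js ! t \<noteq> p i"
      using js by (metis length_replicate nth_equalityI nth_replicate)
    then have "A (i # js) = 0"
      unfolding R[OF js] by (auto intro!: prod_zero R0)
    then show ?thesis using False by simp
  qed
  then have "sgn_tensor A = tensor_prod 2 k (tensor_of_matrix (D ** P)) (unit_tensor k)"
    using sgn_tensor_eq_monomial_iff[OF assms(2) k D P_def] by blast
  moreover have "permutation_matrix P"
    using perm P_def by (auto simp: permutation_matrix_def)
  ultimately show "\<exists>P D :: real ^ 'n ^ 'n. permutation_matrix P \<and>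
       diagonal_matrix D \<and> (\<forall>i. D $ i $ i \<in> {1, -1}) \<and>
       (odd k \<longrightarrow> D = mat 1) \<and>
       sgn_tensor A = tensor_prod 2 k (tensor_of_matrix (D ** P)) (unit_tensor k)"
    using D D_sign D_odd by blast
next
  have k: "2 \<le> k" using assms(1) by simp
  assume "\<exists>P D :: real ^ 'n ^ 'n. permutation_matrix P \<and>
       diagonal_matrix D \<and> (\<forall>i. D $ i $ i \<in> {1, -1}) \<and>
       (odd k \<longrightarrow> D = mat 1) \<and>
       sgn_tensor A = tensor_prod 2 k (tensor_of_matrix (D ** P)) (unit_tensor k)"
  then obtain P D :: "real ^ 'n ^ 'n" and p where perm: "p permutes UNIV"
    and P: "P = (\<chi> i j. if j = p i then 1 else 0)"
    and D: "diagonal_matrix D" "\<And>i. D $ i $ i \<in> {1, -1}" "odd k \<Longrightarrow> D = mat 1"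
    and sgn_A: "sgn_tensor A = tensor_prod 2 k (tensor_of_matrix (D ** P)) (unit_tensor k)"
    unfolding permutation_matrix_def by blast
  show "has_order2_sign_right_inverse k A"
    unfolding has_order2_sign_right_inverse_def
  proof
    fix B assume "B \<in> sign_class k A"
    then have "B \<in> tensors k"
      and "sgn_tensor B = tensor_prod 2 k (tensor_of_matrix (D ** P)) (unit_tensor k)"
      using sgn_A by (auto simp: sign_class_def)
    then have "sgn (B (i # js)) = (if js = replicate (k - 1) (p i) then D $ i $ i else 0)"
      if "length js = k - 1" for i js
      using sgn_tensor_eq_monomial_iff[OF _ k D(1) P] that by blast
    then show "\<exists>Q. is_order2_right_inverse k B Q"
      using D by (intro monomial_sign_imp_right_inverse[OF perm k, of "\<lambda>i. D $ i $ i"])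
        (auto simp: mat_def)
  qed
qed

end
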